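(* Let $m,n,l\ge 1$ be integers, let $\mathcal X=\{\mathbf x^{(1)},\dots,\mathbf x^{(l)}\}\subset\mathbb R^n$ and $\mathcal Y=\{\mathbf y^{(1)},\dots,\mathbf y^{(l)}\}\subset\mathbb R^m$ be given, and let $c_3^{(s)}$ be a finite positive real number. Let $G\in\mathbb R^{m\times n}$, $u^{(4)}\in\mathbb R$, $\mathbf u^{(2)}\in\mathbb R^m$, $\mathbf h\in\mathbb R^n$ have i.i.d. standard normal components and be independent of each other. Then $$\log\mathbb E_{G,u^{(4)}}\,e^{c_3^{(s)}\max_{\mathbf x^{(i_1)}\in\mathcal X,\,\mathbf y^{(i_2)}\in\mathcal Y}\left((\mathbf y^{(i_2)})^TG\mathbf x^{(i_1)}+\|\mathbf x^{(i_1)}\|_2\|\mathbf y^{(i_2)}\|_2u^{(4)}\right)}\ \le\ \log\mathbb E_{\mathbf u^{(2)},\mathbf h}\,e^{c_3^{(s)}\max_{\mathbf x^{(i_1)}\in\mathcal X,\,\mathbf y^{(i_2)}\in\mathcal Y}\left(\|\mathbf x^{(i_1)}\|_2(\mathbf y^{(i_2)})^T\mathbf u^{(2)}+\|\mathbf y^{(i_2)}\|_2\mathbf h^T\mathbf x^{(i_1)}\right)}.$$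
   Context: The superscript in $c_3^{(s)}$ is only a label. $\mathbb E$ denotes expectation over the variables in its subscript. *)

theory Defs
  imports "HOL-Probability.Probability"
begin

definition iid_std_normal :: "'a measure \<Rightarrow> ('i \<Rightarrow> 'a \<Rightarrow> real) \<Rightarrow> bool" where
  "iid_std_normal M Z \<longleftrightarrow>
     prob_space.indep_vars M (\<lambda>_. borel) Z UNIV \<and>
     (\<forall>k. distributed M lborel (Z k) std_normal_density)"

text \<open>
  The scalar components of a random \<open>m \<times> n\<close> matrix, a random scalar, a random \<open>m\<close>-vector and a
  random \<open>n\<close>-vector, collected into a single family. Independence of this family says at once that
  the components of each object are independent and that the four objects are independent of each
  other; the latter cannot be stated by \<^term>\<open>prob_space.indep_vars\<close> on the objects
  themselves, as they have different types.
\<close>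

fun scalar_components ::
  "('a \<Rightarrow> real ^ 'n ^ 'm) \<Rightarrow> ('a \<Rightarrow> real) \<Rightarrow> ('a \<Rightarrow> real ^ 'm) \<Rightarrow> ('a \<Rightarrow> real ^ 'n)
    \<Rightarrow> ('m \<times> 'n) + unit + 'm + 'n \<Rightarrow> 'a \<Rightarrow> real" where
  "scalar_components G s u h (Inl (i, j)) \<omega> = G \<omega> $ i $ j"
| "scalar_components G s u h (Inr (Inl _)) \<omega> = s \<omega>"
| "scalar_components G s u h (Inr (Inr (Inl i))) \<omega> = u \<omega> $ i"
| "scalar_components G s u h (Inr (Inr (Inr j))) \<omega> = h \<omega> $ j"

end

(* Both exponents are maxima of centred Gaussian families A, B indexed by the pairs p = (a, b) in
   X x Y, with equal variances and
   Cov A - Cov B = (|a||a'| - a.a') (|b||b'| - b.b') >= 0.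
   The claim is then Slepian's comparison: with F(z) = (sum_p exp (z_p))^r and 0 < r <= 1, the mixed
   second partial derivatives of F are nonpositive. Since A and B are independent, differentiating
   E F(cos t A + sin t B) and integrating by parts in each Gaussian coordinate gives
   cos t sin t * sum_{p,q} (Cov B - Cov A)_{pq} E F_{pq} >= 0, so E F(A) <= E F(B).
   Scaling the families by c / r and letting r tend to 0 turns F into exp (c max_p z_p). *)

theory Submission
  imports Defs "HOL-Real_Asymp.Real_Asymp"
begin

subsection \<open>Gaussian integration by parts\<close>

abbreviation std_normal :: "real measure" where
  "std_normal \<equiv> density lborel std_normal_density"

abbreviation std_gauss :: "('k::finite \<Rightarrow> real) measure" where
  "std_gauss \<equiv> PiM UNIV (\<lambda>_. std_normal)"

lemma prob_space_std_normal: "prob_space std_normal"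
  by (rule prob_space_normal_density) simp

text \<open>Completing the square turns the density times \<open>exp (c * x)\<close> into a multiple
  of the normal density with mean \<open>c\<close>. The absolute value is handled by adding the
  cases \<open>c = R\<close> and \<open>c = - R\<close>.\<close>

lemma integrable_std_normal_exp_abs:
  "integrable std_normal (\<lambda>x. exp (R * \<bar>x\<bar>))"
proof -
  have shift: "integrable lborel (\<lambda>x. std_normal_density x * exp (c * x))" for c :: real
  proof -
    have "std_normal_density x * exp (c * x) = exp (c\<^sup>2 / 2) * normal_density c 1 x" for x
      by (simp add: normal_density_def exp_add [symmetric] power2_eq_square field_simps)
    then show ?thesis
      by (auto intro: integrable_normal_density)
  qed
  have "integrable lborel (\<lambda>x. std_normal_density x * exp (R * \<bar>x\<bar>))"
  proof (rule Bochner_Integration.integrable_bound)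
    show "integrable lborel (\<lambda>x. std_normal_density x * exp (R * x) + std_normal_density x * exp ((-R) * x))"
      by (intro Bochner_Integration.integrable_add shift)
    have "std_normal_density x * exp (R * \<bar>x\<bar>)
      \<le> std_normal_density x * exp (R * x) + std_normal_density x * exp ((-R) * x)" for x
      by (cases "x \<ge> 0") auto
    then show "AE x in lborel. norm (std_normal_density x * exp (R * \<bar>x\<bar>))
      \<le> norm (std_normal_density x * exp (R * x) + std_normal_density x * exp ((-R) * x))"
      by (auto simp: abs_mult)
  qed measurable
  then show ?thesis
    by (subst integrable_density) auto
qed

text \<open>Growth at most \<open>C * exp (R * \<bar>x\<bar>)\<close> is the regularity class used
  throughout: multiplication by \<open>x\<close> keeps it, with \<open>R + 1\<close> for
  \<open>R\<close>, and powers of sums of exponentials of linear forms belong to it together with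
  their derivatives.\<close>

lemma integrable_std_normal_bound:
  fixes f :: "real \<Rightarrow> real"
  assumes [measurable]: "f \<in> borel_measurable borel"
    and bnd: "\<And>x. \<bar>f x\<bar> \<le> C * exp (R * \<bar>x\<bar>)"
  shows "integrable std_normal f"
proof (rule Bochner_Integration.integrable_bound)
  show "integrable std_normal (\<lambda>x. C * exp (R * \<bar>x\<bar>))"
    using integrable_std_normal_exp_abs by simp
  show "AE x in std_normal. norm (f x) \<le> norm (C * exp (R * \<bar>x\<bar>))"
    using bnd by (intro AE_I2) (metis abs_ge_self order_trans real_norm_def)
qed simp

lemma le_exp_abs: "\<bar>x::real\<bar> \<le> exp \<bar>x\<bar>"
  using exp_ge_add_one_self [of "\<bar>x\<bar>"] by linarith

text \<open>The standard normal density has derivative \<open>- x\<close> times itself, so the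
  derivative of density times \<open>f\<close> is the difference of the two integrands. Its integral
  over the line is zero because the growth bound on \<open>f\<close> kills the boundary terms.
  Continuity of \<open>f'\<close> serves the fundamental theorem of calculus.\<close>

lemma stein_std_normal:
  fixes f f' :: "real \<Rightarrow> real"
  assumes deriv: "\<And>x. (f has_real_derivative f' x) (at x)"
    and cont: "\<And>x. isCont f' x"
    and bf: "\<And>x. \<bar>f x\<bar> \<le> C * exp (R * \<bar>x\<bar>)"
    and bf': "\<And>x. \<bar>f' x\<bar> \<le> C * exp (R * \<bar>x\<bar>)"
  shows "(\<integral>x. x * f x \<partial>std_normal) = (\<integral>x. f' x \<partial>std_normal)"
proof -
  have [measurable]: "f \<in> borel_measurable borel" "f' \<in> borel_measurable borel"
    using deriv cont by (auto intro!: borel_measurable_continuous_onI DERIV_isCont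
        simp: continuous_on_eq_continuous_at)
  have i1: "integrable std_normal f'"
    by (rule integrable_std_normal_bound [OF _ bf']) simp
  have i2: "integrable std_normal (\<lambda>x. x * f x)"
  proof (rule integrable_std_normal_bound)
    fix x
    have "\<bar>x * f x\<bar> \<le> exp \<bar>x\<bar> * (C * exp (R * \<bar>x\<bar>))"
      unfolding abs_mult by (intro mult_mono le_exp_abs bf) auto
    then show "\<bar>x * f x\<bar> \<le> C * exp ((R + 1) * \<bar>x\<bar>)"
      by (simp add: algebra_simps exp_add)
  qed simp
  define D where "D x = std_normal_density x * f' x - std_normal_density x * (x * f x)" for x
  have intD: "integrable lborel D"
    unfolding D_def using i1 i2 by (subst (asm) (1 2) integrable_density) auto
  have dn: "(std_normal_density has_real_derivative - x * std_normal_density x) (at x)" for x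
  proof -
    have "((\<lambda>x. c * exp (- x\<^sup>2 / 2)) has_real_derivative - x * (c * exp (- x\<^sup>2 / 2))) (at x)" for c
      by (auto intro!: derivative_eq_intros)
    then show ?thesis
      unfolding std_normal_density_def .
  qed
  have cn: "isCont std_normal_density x" for x
    using dn DERIV_isCont by blast
  have "(LBINT x=-\<infinity>..\<infinity>. D x) = 0 - 0"
  proof (rule interval_integral_FTC_integrable [where F = "\<lambda>x. std_normal_density x * f x"])
    show "((\<lambda>x. std_normal_density x * f x) has_vector_derivative D x) (at x)" for x
      unfolding has_real_derivative_iff_has_vector_derivative [symmetric] D_def
      by (rule derivative_eq_intros dn deriv refl)+ (simp add: algebra_simps)
    show "isCont D x" for x
      unfolding D_def by (intro continuous_intros cn cont DERIV_isCont [OF deriv])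
    show "set_integrable lborel (einterval (-\<infinity>) \<infinity>) D"
      using intD by (simp add: set_integrable_def)
    have le: "norm (std_normal_density x * f x) \<le> C * exp (R\<^sup>2) * exp (- x\<^sup>2 / 4)" for x
    proof -
      have "C \<ge> 0"
        using bf [of 0] by simp
      \<comment> \<open>Young's inequality with weights that spend only half of the Gaussian
        exponent; the other half remains for the decay at both ends.\<close>
      have "R * \<bar>x\<bar> \<le> R\<^sup>2 + \<bar>x\<bar>\<^sup>2 / 4"
        using zero_le_power2 [of "R - \<bar>x\<bar> / 2"] by (simp add: power2_diff power_divide)
      then have "exp (- x\<^sup>2 / 2) * exp (R * \<bar>x\<bar>) \<le> exp (R\<^sup>2) * exp (- x\<^sup>2 / 4)"
        by (simp add: exp_add [symmetric])
      from mult_left_mono [OF this \<open>C \<ge> 0\<close>]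
      have "exp (- x\<^sup>2 / 2) * (C * exp (R * \<bar>x\<bar>)) \<le> C * exp (R\<^sup>2) * exp (- x\<^sup>2 / 4)"
        by (simp add: mult_ac)
      moreover have "std_normal_density x \<le> exp (- x\<^sup>2 / 2)"
        using pi_ge_two by (simp add: std_normal_density_def divide_le_eq)
      then have "norm (std_normal_density x * f x) \<le> exp (- x\<^sup>2 / 2) * (C * exp (R * \<bar>x\<bar>))"
        unfolding real_norm_def abs_mult by (intro mult_mono bf) auto
      ultimately show ?thesis
        by linarith
    qed
    have decay: "((\<lambda>x::real. C * exp (R\<^sup>2) * exp (- x\<^sup>2 / 4)) \<longlongrightarrow> 0) at_top"
      "((\<lambda>x::real. C * exp (R\<^sup>2) * exp (- x\<^sup>2 / 4)) \<longlongrightarrow> 0) at_bot"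
      by (rule tendsto_mult_right_zero, real_asymp)+
    have "((\<lambda>x. std_normal_density x * f x) \<longlongrightarrow> 0) at_top"
      by (rule Lim_null_comparison [OF always_eventually decay(1)]) (use le in blast)
    then show "(((\<lambda>x. std_normal_density x * f x) \<circ> real_of_ereal) \<longlongrightarrow> 0) (at_left \<infinity>)"
      by (simp add: ereal_tendsto_simps)
    have "((\<lambda>x. std_normal_density x * f x) \<longlongrightarrow> 0) at_bot"
      by (rule Lim_null_comparison [OF always_eventually decay(2)]) (use le in blast)
    then show "(((\<lambda>x. std_normal_density x * f x) \<circ> real_of_ereal) \<longlongrightarrow> 0) (at_right (-\<infinity>))"
      by (simp add: ereal_tendsto_simps)
  qed simp
  then have "(\<integral>x. D x \<partial>lborel) = 0"
    by (simp add: interval_lebesgue_integral_def set_lebesgue_integral_def)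
  moreover have "(\<integral>x. D x \<partial>lborel) = (\<integral>x. f' x \<partial>std_normal) - (\<integral>x. x * f x \<partial>std_normal)"
    unfolding D_def using i1 i2
    by (subst (asm) (1 2) integrable_density) (auto simp: integral_density)
  ultimately show ?thesis
    by simp
qed

text \<open>The dominating exponential of a sum factors over the coordinates, so its integral is a
  product of one-dimensional ones.\<close>

lemma integrable_std_gauss_bound:
  fixes f :: "('k::finite \<Rightarrow> real) \<Rightarrow> real"
  assumes [measurable]: "f \<in> borel_measurable std_gauss"
    and bnd: "\<And>g. \<bar>f g\<bar> \<le> C * exp (R * (\<Sum>k\<in>UNIV. \<bar>g k\<bar>))"
  shows "integrable std_gauss f"
proof (rule Bochner_Integration.integrable_bound)
  interpret prob_space std_normal by (rule prob_space_std_normal)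
  interpret product_sigma_finite "\<lambda>_::'k. std_normal" ..
  have "integrable std_gauss (\<lambda>g. \<Prod>k\<in>(UNIV::'k set). exp (R * \<bar>g k\<bar>))"
    by (rule product_integrable_prod) (auto intro: integrable_std_normal_exp_abs)
  then show "integrable std_gauss (\<lambda>g. C * exp (R * (\<Sum>k\<in>(UNIV::'k set). \<bar>g k\<bar>)))"
    by (simp add: exp_sum sum_distrib_left)
  show "AE g in std_gauss. norm (f g) \<le> norm (C * exp (R * (\<Sum>k\<in>UNIV. \<bar>g k\<bar>)))"
    using bnd by (intro AE_I2) (metis abs_ge_self order_trans real_norm_def)
qed simp

lemma stein_std_gauss:
  fixes f f' :: "('k::finite \<Rightarrow> real) \<Rightarrow> real"
  assumes [measurable]: "f \<in> borel_measurable std_gauss" "f' \<in> borel_measurable std_gauss"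
    and deriv: "\<And>g x. ((\<lambda>x. f (g(k := x))) has_real_derivative f' (g(k := x))) (at x)"
    and cont: "\<And>g x. isCont (\<lambda>x. f' (g(k := x))) x"
    and bf: "\<And>g. \<bar>f g\<bar> \<le> C * exp (R * (\<Sum>k\<in>UNIV. \<bar>g k\<bar>))"
    and bf': "\<And>g. \<bar>f' g\<bar> \<le> C * exp (R * (\<Sum>k\<in>UNIV. \<bar>g k\<bar>))"
  shows "integrable std_gauss (\<lambda>g. g k * f g)"
    and "(\<integral>g. g k * f g \<partial>std_gauss) = (\<integral>g. f' g \<partial>std_gauss)"
proof -
  interpret prob_space std_normal by (rule prob_space_std_normal)
  interpret product_sigma_finite "\<lambda>_::'k. std_normal" ..
  have split: "(\<Sum>j\<in>UNIV. \<bar>g j\<bar>) = \<bar>g k\<bar> + (\<Sum>j\<in>-{k}. \<bar>g j\<bar>)" for g :: "'k \<Rightarrow> real"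
    by (subst sum.remove [of _ k]) (auto simp: Compl_eq_Diff_UNIV)
  show i2: "integrable std_gauss (\<lambda>g. g k * f g)"
  proof (rule integrable_std_gauss_bound)
    fix g :: "'k \<Rightarrow> real"
    have "\<bar>g k\<bar> \<le> (\<Sum>j\<in>UNIV. \<bar>g j\<bar>)"
      by (rule member_le_sum) auto
    then have "\<bar>g k\<bar> \<le> exp (\<Sum>j\<in>UNIV. \<bar>g j\<bar>)"
      using exp_ge_add_one_self [of "\<Sum>j\<in>UNIV. \<bar>g j\<bar>"] by linarith
    then have "\<bar>g k * f g\<bar> \<le> exp (\<Sum>j\<in>UNIV. \<bar>g j\<bar>) * (C * exp (R * (\<Sum>j\<in>UNIV. \<bar>g j\<bar>)))"
      unfolding abs_mult by (intro mult_mono bf) auto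
    then show "\<bar>g k * f g\<bar> \<le> C * exp ((R + 1) * (\<Sum>j\<in>UNIV. \<bar>g j\<bar>))"
      by (simp add: algebra_simps exp_add)
  qed measurable
  have i1: "integrable std_gauss f'"
    by (rule integrable_std_gauss_bound [OF _ bf']) measurable
  have ins: "insert k (-{k}) = (UNIV :: 'k set)"
    by auto
  have fub: "(\<integral>g. F g \<partial>std_gauss) = (\<integral>g. (\<integral>x. F (g(k := x)) \<partial>std_normal) \<partial>PiM (-{k}) (\<lambda>_. std_normal))"
    if "integrable std_gauss F" for F :: "('k \<Rightarrow> real) \<Rightarrow> real"
    using product_integral_insert [of "-{k}" k F] that by (simp add: ins)
  have "(\<integral>x. x * f (g(k := x)) \<partial>std_normal) = (\<integral>x. f' (g(k := x)) \<partial>std_normal)" for g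
  proof (rule stein_std_normal [where C = "C * exp (R * (\<Sum>j\<in>-{k}. \<bar>g j\<bar>))" and R = R])
    have s: "(\<Sum>j\<in>UNIV. \<bar>(g(k := x)) j\<bar>) = \<bar>x\<bar> + (\<Sum>j\<in>-{k}. \<bar>g j\<bar>)" for x
      by (subst split) (auto intro!: sum.cong)
    show "\<bar>f (g(k := x))\<bar> \<le> C * exp (R * (\<Sum>j\<in>-{k}. \<bar>g j\<bar>)) * exp (R * \<bar>x\<bar>)" for x
      using bf [of "g(k := x)"] unfolding s by (simp add: algebra_simps exp_add)
    show "\<bar>f' (g(k := x))\<bar> \<le> C * exp (R * (\<Sum>j\<in>-{k}. \<bar>g j\<bar>)) * exp (R * \<bar>x\<bar>)" for x
      using bf' [of "g(k := x)"] unfolding s by (simp add: algebra_simps exp_add)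
  qed (rule deriv cont)+
  then show "(\<integral>g. g k * f g \<partial>std_gauss) = (\<integral>g. f' g \<partial>std_gauss)"
    by (subst (1 2) fub) (auto simp: i1 i2)
qed

subsection \<open>Powers of a sum of exponentials\<close>

text \<open>The mean value inequality bounds every difference quotient by \<open>w\<close>, since
  \<open>w\<close> dominates \<open>f'\<close> uniformly in \<open>t\<close>. Dominated convergence
  along sequences then gives the limit.\<close>

lemma DERIV_integral_dominated:
  fixes f f' :: "real \<Rightarrow> 'a \<Rightarrow> real"
  assumes deriv: "\<And>t \<omega>. ((\<lambda>t. f t \<omega>) has_real_derivative f' t \<omega>) (at t)"
    and int: "\<And>t. integrable M (f t)"
    and meas: "f' t \<in> borel_measurable M"
    and w: "integrable M w" "\<And>t \<omega>. \<bar>f' t \<omega>\<bar> \<le> w \<omega>"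
  shows "((\<lambda>t. \<integral>\<omega>. f t \<omega> \<partial>M) has_real_derivative (\<integral>\<omega>. f' t \<omega> \<partial>M)) (at t)"
  unfolding has_field_derivative_iff tendsto_at_iff_sequentially comp_def
proof (intro allI impI)
  fix s :: "nat \<Rightarrow> real"
  assume s: "\<forall>i. s i \<in> UNIV - {t}" and lim: "s \<longlonglongrightarrow> t"
  have "(\<lambda>i. \<integral>\<omega>. (f (s i) \<omega> - f t \<omega>) / (s i - t) \<partial>M) \<longlonglongrightarrow> (\<integral>\<omega>. f' t \<omega> \<partial>M)"
  proof (rule integral_dominated_convergence [where w = w])
    show "(\<lambda>\<omega>. (f (s i) \<omega> - f t \<omega>) / (s i - t)) \<in> borel_measurable M" for i
      using int [THEN borel_measurable_integrable] by measurable
    have "((\<lambda>u. (f u \<omega> - f t \<omega>) / (u - t)) \<longlongrightarrow> f' t \<omega>) (at t)" for \<omega>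
      using deriv [of \<omega> t] by (simp add: has_field_derivative_iff)
    then show "AE \<omega> in M. (\<lambda>i. (f (s i) \<omega> - f t \<omega>) / (s i - t)) \<longlonglongrightarrow> f' t \<omega>"
      using s lim unfolding tendsto_at_iff_sequentially comp_def by blast
    have "norm ((f (s i) \<omega> - f t \<omega>) / (s i - t)) \<le> w \<omega>" for i \<omega>
    proof -
      have "norm (f (s i) \<omega> - f t \<omega>) \<le> w \<omega> * norm (s i - t)"
        by (rule field_differentiable_bound [where S = UNIV and f' = "\<lambda>u. f' u \<omega>"])
          (use deriv w(2) in auto)
      moreover have "s i \<noteq> t"
        using s by auto
      ultimately show ?thesis
        by (simp add: norm_divide divide_le_eq)
    qed
    then show "AE \<omega> in M. norm ((f (s i) \<omega> - f t \<omega>) / (s i - t)) \<le> w \<omega>" for i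
      by simp
  qed (use w meas in auto)
  then show "(\<lambda>i. ((\<integral>\<omega>. f (s i) \<omega> \<partial>M) - (\<integral>\<omega>. f t \<omega> \<partial>M)) / (s i - t)) \<longlonglongrightarrow> (\<integral>\<omega>. f' t \<omega> \<partial>M)"
    by (simp add: int)
qed

section \<open>The smooth functional: derivatives, growth and sign of the mixed derivatives\<close>

definition sum_exp :: "'p set \<Rightarrow> ('p \<Rightarrow> real) \<Rightarrow> real" where
  "sum_exp P z = (\<Sum>p\<in>P. exp (z p))"

text \<open>For \<open>p\<close> and \<open>q\<close> in \<open>P\<close>, \<open>grad\<close> and
  \<open>hess\<close> are the first and second partial derivatives of
  \<open>sum_exp P z powr r\<close> in these coordinates.\<close>

definition grad :: "real \<Rightarrow> 'p set \<Rightarrow> 'p \<Rightarrow> ('p \<Rightarrow> real) \<Rightarrow> real" where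
  "grad r P p z = r * exp (z p) * sum_exp P z powr (r - 1)"

definition hess :: "real \<Rightarrow> 'p set \<Rightarrow> 'p \<Rightarrow> 'p \<Rightarrow> ('p \<Rightarrow> real) \<Rightarrow> real" where
  "hess r P p q z = (if p = q then r * exp (z p) * sum_exp P z powr (r - 1) else 0)
     + r * (r - 1) * exp (z p) * exp (z q) * sum_exp P z powr (r - 2)"

lemma sum_exp_pos: "finite P \<Longrightarrow> P \<noteq> {} \<Longrightarrow> sum_exp P z > 0"
  by (simp add: sum_exp_def sum_pos)

lemma DERIV_sum_exp_powr:
  assumes P: "finite P" "P \<noteq> {}"
    and z: "\<And>p. p \<in> P \<Longrightarrow> (z p has_real_derivative z' p) (at t)"
  shows "((\<lambda>t. sum_exp P (\<lambda>p. z p t) powr r) has_real_derivative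
    r * sum_exp P (\<lambda>p. z p t) powr (r - 1) * (\<Sum>p\<in>P. z' p * exp (z p t))) (at t)"
proof -
  have "((\<lambda>t. sum_exp P (\<lambda>p. z p t)) has_real_derivative (\<Sum>p\<in>P. z' p * exp (z p t))) (at t)"
    unfolding sum_exp_def
    by (rule DERIV_sum) (use z in \<open>auto intro!: derivative_eq_intros simp: mult.commute\<close>)
  then have "((\<lambda>t. sum_exp P (\<lambda>p. z p t) powr r) has_real_derivative
    r * sum_exp P (\<lambda>p. z p t) powr (r - of_nat 1) * (\<Sum>p\<in>P. z' p * exp (z p t))) (at t)"
    by (rule DERIV_fun_powr) (rule sum_exp_pos [OF P])
  then show ?thesis
    by simp
qed

lemma DERIV_sum_exp_powr_grad:
  assumes "finite P" "P \<noteq> {}"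
    and "\<And>p. p \<in> P \<Longrightarrow> (z p has_real_derivative z' p) (at t)"
  shows "((\<lambda>t. sum_exp P (\<lambda>p. z p t) powr r) has_real_derivative
    (\<Sum>p\<in>P. z' p * grad r P p (\<lambda>p. z p t))) (at t)"
  using DERIV_sum_exp_powr [OF assms, where r = r]
  by (simp add: grad_def sum_distrib_left mult_ac)

text \<open>Product rule: differentiating the factor \<open>exp (z p)\<close> yields the diagonal
  term of \<open>hess\<close>, differentiating the power yields the term present for every
  \<open>q\<close>.\<close>

lemma DERIV_grad_hess:
  assumes P: "finite P" "P \<noteq> {}" and p: "p \<in> P"
    and z: "\<And>p. p \<in> P \<Longrightarrow> (z p has_real_derivative z' p) (at t)"
  shows "((\<lambda>t. grad r P p (\<lambda>p. z p t)) has_real_derivative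
    (\<Sum>q\<in>P. z' q * hess r P p q (\<lambda>p. z p t))) (at t)"
proof -
  let ?S = "sum_exp P (\<lambda>p. z p t)"
  have "((\<lambda>t. r * exp (z p t) * sum_exp P (\<lambda>p. z p t) powr (r - 1)) has_real_derivative
     r * exp (z p t) * ((r - 1) * ?S powr (r - 1 - 1) * (\<Sum>q\<in>P. z' q * exp (z q t)))
     + z' p * (r * exp (z p t)) * ?S powr (r - 1)) (at t)"
    by (rule derivative_eq_intros DERIV_sum_exp_powr z P p refl | simp add: algebra_simps)+
  moreover have "(\<Sum>q\<in>P. z' q * hess r P p q (\<lambda>p. z p t)) =
     r * exp (z p t) * ((r - 1) * ?S powr (r - 1 - 1) * (\<Sum>q\<in>P. z' q * exp (z q t)))
     + z' p * (r * exp (z p t)) * ?S powr (r - 1)"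
  proof -
    have "(\<Sum>q\<in>P. z' q * hess r P p q (\<lambda>p. z p t)) =
      (\<Sum>q\<in>P. (if p = q then z' p * (r * exp (z p t)) * ?S powr (r - 1) else 0)
        + r * exp (z p t) * ((r - 1) * ?S powr (r - 1 - 1) * (z' q * exp (z q t))))"
      by (intro sum.cong) (auto simp: hess_def algebra_simps)
    also have "\<dots> = z' p * (r * exp (z p t)) * ?S powr (r - 1)
        + r * exp (z p t) * ((r - 1) * ?S powr (r - 1 - 1) * (\<Sum>q\<in>P. z' q * exp (z q t)))"
      using P p by (subst sum.distrib) (simp add: sum_distrib_left)
    finally show ?thesis
      by simp
  qed
  ultimately show ?thesis
    by (simp add: grad_def)
qed

text \<open>Each \<open>exp (z p)\<close> is at most the whole sum S, so every exponential can be
  traded for a power of S and all three quantities are bounded by at most 2 times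
  \<open>S powr r\<close>. As \<open>r \<le> 1\<close>, this power grows no faster than
  \<open>1 + S\<close>. The two terms of \<open>hess\<close> account for the factor 2 in the common
  constant.\<close>

lemma
  assumes P: "finite P" "P \<noteq> {}" and r: "0 < r" "r \<le> 1"
    and w: "0 \<le> w" "\<And>p. p \<in> P \<Longrightarrow> \<bar>z p\<bar> \<le> w"
  shows sum_exp_powr_bound: "\<bar>sum_exp P z powr r\<bar> \<le> (2 + 2 * card P) * exp w"
    and grad_bound: "p \<in> P \<Longrightarrow> \<bar>grad r P p z\<bar> \<le> (2 + 2 * card P) * exp w"
    and hess_bound: "p \<in> P \<Longrightarrow> q \<in> P \<Longrightarrow> \<bar>hess r P p q z\<bar> \<le> (2 + 2 * card P) * exp w"
proof -
  let ?S = "sum_exp P z"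
  have S0: "?S > 0"
    using P by (rule sum_exp_pos)
  \<comment> \<open>The sum may be smaller than 1; passing to a base of at least 1 makes the power
    monotone in its exponent.\<close>
  have "?S powr r \<le> (1 + ?S) powr r"
    using S0 r by (intro powr_mono2) auto
  also have "\<dots> \<le> (1 + ?S) powr 1"
    using S0 r by (intro powr_mono) auto
  also have "\<dots> = 1 + ?S"
    using S0 by simp
  also have "?S \<le> (\<Sum>p\<in>P. exp w)"
    unfolding sum_exp_def using w(2) by (intro sum_mono) (auto simp: abs_le_iff)
  also have "1 + (\<Sum>p\<in>P. exp w) \<le> (1 + card P) * exp w"
    using w by (simp add: algebra_simps)
  finally have F: "?S powr r \<le> (1 + card P) * exp w"
    by simp
  also have "\<dots> \<le> (2 + 2 * card P) * exp w"
    by simp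
  finally show "\<bar>?S powr r\<bar> \<le> (2 + 2 * card P) * exp w"
    by simp
  have e: "exp (z p) \<le> ?S" if "p \<in> P" for p
    unfolding sum_exp_def using P that by (intro member_le_sum) auto
  have S1: "?S powr (r - 1) * ?S = ?S powr r" "?S powr (r - 2) * ?S * ?S = ?S powr r"
    using S0 by (simp_all add: powr_diff powr_numeral power2_eq_square field_simps)
  have g: "r * exp (z p) * ?S powr (r - 1) \<le> ?S powr r" if "p \<in> P" for p
  proof -
    have "r * exp (z p) * ?S powr (r - 1) \<le> 1 * ?S * ?S powr (r - 1)"
      using e that r S0 by (intro mult_mono) auto
    then show ?thesis
      using S1 by (simp add: mult_ac)
  qed
  have ab: "\<bar>grad r P p z\<bar> \<le> ?S powr r" if "p \<in> P" for p
    using g [OF that] r by (simp add: grad_def abs_mult)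
  show "\<bar>grad r P p z\<bar> \<le> (2 + 2 * card P) * exp w" if "p \<in> P"
    using ab [OF that] F \<open>(1 + card P) * exp w \<le> (2 + 2 * card P) * exp w\<close> by linarith
  show "\<bar>hess r P p q z\<bar> \<le> (2 + 2 * card P) * exp w" if "p \<in> P" "q \<in> P"
  proof -
    have "r * (1 - r) * exp (z p) * exp (z q) * ?S powr (r - 2) \<le> 1 * 1 * ?S * ?S * ?S powr (r - 2)"
      using e that r S0 by (intro mult_mono) auto
    then have "r * (1 - r) * exp (z p) * exp (z q) * ?S powr (r - 2) \<le> ?S powr r"
      using S1 by (simp add: mult_ac)
    moreover have "\<bar>r * (r - 1) * exp (z p) * exp (z q) * ?S powr (r - 2)\<bar>
        = r * (1 - r) * exp (z p) * exp (z q) * ?S powr (r - 2)"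
      using r by (simp add: abs_mult)
    moreover have "\<bar>if p = q then r * exp (z p) * ?S powr (r - 1) else 0\<bar> \<le> ?S powr r"
      using g [OF that(1)] r by (auto simp: abs_mult)
    ultimately have "\<bar>hess r P p q z\<bar> \<le> ?S powr r + ?S powr r"
      unfolding hess_def by linarith
    also have "\<dots> \<le> (1 + card P) * exp w + (1 + card P) * exp w"
      using F by (intro add_mono)
    finally show ?thesis
      by (simp add: algebra_simps)
  qed
qed

text \<open>Off the diagonal only the term with the factor \<open>r * (r - 1)\<close> remains. This
  sign drives the comparison and is the reason for taking \<open>r \<le> 1\<close>.\<close>

lemma hess_nonpos: "p \<noteq> q \<Longrightarrow> 0 < r \<Longrightarrow> r \<le> 1 \<Longrightarrow> hess r P p q z \<le> 0"
  by (simp add: hess_def mult_nonneg_nonpos mult_nonpos_nonneg)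

lemma isCont_hess:
  assumes P: "finite P" "P \<noteq> {}" "p \<in> P" "q \<in> P"
    and z: "\<And>p. p \<in> P \<Longrightarrow> isCont (z p) t"
  shows "isCont (\<lambda>t. hess r P p q (\<lambda>p. z p t)) t"
proof -
  have "isCont (\<lambda>t. sum_exp P (\<lambda>p. z p t)) t"
    unfolding sum_exp_def by (intro continuous_intros z)
  moreover have "sum_exp P (\<lambda>p. z p u) \<noteq> 0" for u
    using sum_exp_pos [OF P(1,2), of "\<lambda>p. z p u"] by simp
  ultimately show ?thesis
    unfolding hess_def using P
    by (cases "p = q") (auto intro!: continuous_intros z)
qed

section \<open>Gaussian linear forms and integration by parts along them\<close>

abbreviation lin :: "('k::finite \<Rightarrow> real) \<Rightarrow> ('k \<Rightarrow> real) \<Rightarrow> real" where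
  "lin a g \<equiv> (\<Sum>k\<in>UNIV. a k * g k)"

lemma measurable_lin_std_gauss [measurable]: "lin a \<in> borel_measurable std_gauss"
  by measurable

lemma measurable_sum_exp_std_gauss [measurable]:
  "(\<lambda>g. sum_exp P (\<lambda>p. lin (c p) g) powr r) \<in> borel_measurable std_gauss"
  "(\<lambda>g. grad r P p (\<lambda>p. lin (c p) g)) \<in> borel_measurable std_gauss"
  "(\<lambda>g. hess r P p q (\<lambda>p. lin (c p) g)) \<in> borel_measurable std_gauss"
  unfolding grad_def hess_def sum_exp_def by measurable

text \<open>A single constant controls all forms indexed by \<open>P\<close>. The majorant
  \<open>d\<close> is kept apart from \<open>c\<close> so that the constant stays the same when the
  coefficients move with a parameter.\<close>

lemma abs_lin_le:
  assumes "finite P" "p \<in> P"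
    and c: "\<And>k. \<bar>c k\<bar> \<le> d p k" "\<And>q k. d q k \<ge> 0"
  shows "\<bar>lin c g\<bar> \<le> (\<Sum>q\<in>P. \<Sum>k\<in>UNIV. d q k) * (\<Sum>k\<in>UNIV. \<bar>g k\<bar>)"
proof -
  have "\<bar>lin c g\<bar> \<le> (\<Sum>k\<in>UNIV. \<bar>c k\<bar> * \<bar>g k\<bar>)"
    by (rule order_trans [OF sum_abs]) (simp add: abs_mult)
  also have "\<dots> \<le> (\<Sum>k\<in>UNIV. (\<Sum>q\<in>P. \<Sum>k\<in>UNIV. d q k) * \<bar>g k\<bar>)"
  proof (intro sum_mono mult_right_mono)
    fix k
    have "\<bar>c k\<bar> \<le> d p k"
      by (rule c)
    also have "\<dots> \<le> (\<Sum>k\<in>UNIV. d p k)"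
      by (rule member_le_sum) (auto intro: c)
    also have "\<dots> \<le> (\<Sum>q\<in>P. \<Sum>k\<in>UNIV. d q k)"
      using assms by (intro member_le_sum [where f = "\<lambda>q. \<Sum>k\<in>UNIV. d q k"]) (auto intro: sum_nonneg)
    finally show "\<bar>c k\<bar> \<le> (\<Sum>q\<in>P. \<Sum>k\<in>UNIV. d q k)" .
  qed auto
  finally show ?thesis
    by (simp add: sum_distrib_left)
qed

text \<open>Moving coordinate \<open>k\<close> changes the form with index \<open>q\<close> at rate
  \<open>c q k\<close>, so by the chain rule the \<open>k\<close>-th derivative of
  \<open>grad\<close> is a combination of entries of \<open>hess\<close>. Stein's identity in that
  coordinate then gives \<open>stein_grad\<close>.\<close>

lemma
  fixes c :: "'p \<Rightarrow> 'k::finite \<Rightarrow> real"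
  assumes P: "finite P" "P \<noteq> {}" and r: "0 < r" "r \<le> 1"
  shows integrable_sum_exp_powr: "integrable std_gauss (\<lambda>g. sum_exp P (\<lambda>p. lin (c p) g) powr r)"
    and integrable_hess: "p \<in> P \<Longrightarrow> q \<in> P \<Longrightarrow> integrable std_gauss (\<lambda>g. hess r P p q (\<lambda>p. lin (c p) g))"
    and stein_grad_integrable: "p \<in> P \<Longrightarrow> integrable std_gauss (\<lambda>g. g k * grad r P p (\<lambda>p. lin (c p) g))"
    and stein_grad: "p \<in> P \<Longrightarrow> (\<integral>g. g k * grad r P p (\<lambda>p. lin (c p) g) \<partial>std_gauss) =
      (\<Sum>q\<in>P. c q k * (\<integral>g. hess r P p q (\<lambda>p. lin (c p) g) \<partial>std_gauss))"
proof -
  define R where "R = (\<Sum>q\<in>P. \<Sum>k\<in>UNIV. \<bar>c q k\<bar>)"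
  define C :: real where "C = 2 + 2 * card P"
  have R0: "R \<ge> 0"
    by (simp add: R_def sum_nonneg)
  have w: "0 \<le> R * (\<Sum>k\<in>UNIV. \<bar>g k\<bar>)" "q \<in> P \<Longrightarrow> \<bar>lin (c q) g\<bar> \<le> R * (\<Sum>k\<in>UNIV. \<bar>g k\<bar>)" for g q
    using R0 abs_lin_le [OF P(1), of q "c q" "\<lambda>q k. \<bar>c q k\<bar>" g]
    by (auto simp: R_def sum_nonneg)
  note bnds = sum_exp_powr_bound [OF P r w, folded C_def] grad_bound [OF P r w, folded C_def]
    hess_bound [OF P r w, folded C_def]
  show "integrable std_gauss (\<lambda>g. sum_exp P (\<lambda>p. lin (c p) g) powr r)"
    by (rule integrable_std_gauss_bound [where C = C and R = R]) (measurable, (rule bnds)+)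
  show i: "integrable std_gauss (\<lambda>g. hess r P p q (\<lambda>p. lin (c p) g))" if "p \<in> P" "q \<in> P" for p q
    by (rule integrable_std_gauss_bound [where C = C and R = R]) (measurable, (rule bnds that | assumption)+)
  define f' where "f' p g = (\<Sum>q\<in>P. c q k * hess r P p q (\<lambda>p. lin (c p) g))" for p g
  \<comment> \<open>Stein's identity asks for one growth constant for a function and its derivative:
    \<open>C\<close> serves \<open>grad\<close>, the sum serves \<open>f'\<close>, and
    \<open>K\<close> exceeds both.\<close>
  define K where "K = C + (\<Sum>q\<in>P. \<bar>c q k\<bar> * C)"
  have CK: "0 \<le> C" "C \<le> K" "(\<Sum>q\<in>P. \<bar>c q k\<bar> * C) \<le> K"
    by (auto simp: K_def C_def sum_nonneg)
  have lin_upd: "((\<lambda>x. lin (c q) (g(k := x))) has_real_derivative c q k) (at x)" for q g x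
  proof -
    have "((\<lambda>x. lin (c q) (g(k := x))) has_real_derivative (\<Sum>j\<in>UNIV. if j = k then c q k else 0)) (at x)"
      by (rule DERIV_sum) (auto intro!: derivative_eq_intros)
    then show ?thesis
      by simp
  qed
  note st = stein_std_gauss [where f = "\<lambda>g. grad r P p (\<lambda>p. lin (c p) g)" and f' = "f' p" and k = k and C = K and R = R for p]
  have prems: "f' p \<in> borel_measurable std_gauss"
    "((\<lambda>x. grad r P p (\<lambda>q. lin (c q) (g(k := x)))) has_real_derivative f' p (g(k := x))) (at x)"
    "isCont (\<lambda>x. f' p (g(k := x))) x"
    "\<bar>grad r P p (\<lambda>q. lin (c q) g)\<bar> \<le> K * exp (R * (\<Sum>k\<in>UNIV. \<bar>g k\<bar>))"
    "\<bar>f' p g\<bar> \<le> K * exp (R * (\<Sum>k\<in>UNIV. \<bar>g k\<bar>))"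
    if p: "p \<in> P" for p g x
  proof -
    show "f' p \<in> borel_measurable std_gauss"
      unfolding f'_def by measurable
    show "((\<lambda>x. grad r P p (\<lambda>q. lin (c q) (g(k := x)))) has_real_derivative f' p (g(k := x))) (at x)"
      unfolding f'_def by (rule DERIV_grad_hess [OF P p]) (rule lin_upd)
    show "isCont (\<lambda>x. f' p (g(k := x))) x"
      unfolding f'_def
      by (intro continuous_intros isCont_hess P p DERIV_isCont [OF lin_upd])
    have "\<bar>grad r P p (\<lambda>q. lin (c q) g)\<bar> \<le> C * exp (R * (\<Sum>k\<in>UNIV. \<bar>g k\<bar>))"
      by (rule bnds p | assumption)+
    also have "\<dots> \<le> K * exp (R * (\<Sum>k\<in>UNIV. \<bar>g k\<bar>))"
      using CK by (intro mult_right_mono) auto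
    finally show "\<bar>grad r P p (\<lambda>q. lin (c q) g)\<bar> \<le> K * exp (R * (\<Sum>k\<in>UNIV. \<bar>g k\<bar>))" .
    have "\<bar>f' p g\<bar> \<le> (\<Sum>q\<in>P. \<bar>c q k\<bar> * (C * exp (R * (\<Sum>k\<in>UNIV. \<bar>g k\<bar>))))"
      unfolding f'_def
      by (rule order_trans [OF sum_abs]) (auto intro!: sum_mono mult_left_mono bnds p simp: abs_mult)
    also have "\<dots> = (\<Sum>q\<in>P. \<bar>c q k\<bar> * C) * exp (R * (\<Sum>k\<in>UNIV. \<bar>g k\<bar>))"
      by (simp add: sum_distrib_right mult_ac)
    also have "\<dots> \<le> K * exp (R * (\<Sum>k\<in>UNIV. \<bar>g k\<bar>))"
      using CK by (intro mult_right_mono) auto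
    finally show "\<bar>f' p g\<bar> \<le> K * exp (R * (\<Sum>k\<in>UNIV. \<bar>g k\<bar>))" .
  qed
  show "integrable std_gauss (\<lambda>g. g k * grad r P p (\<lambda>p. lin (c p) g))" if "p \<in> P"
    by (rule st(1) [OF measurable_sum_exp_std_gauss(2) prems]) (rule that)+
  show "(\<integral>g. g k * grad r P p (\<lambda>p. lin (c p) g) \<partial>std_gauss) =
      (\<Sum>q\<in>P. c q k * (\<integral>g. hess r P p q (\<lambda>p. lin (c p) g) \<partial>std_gauss))" if "p \<in> P"
  proof -
    have "(\<integral>g. g k * grad r P p (\<lambda>p. lin (c p) g) \<partial>std_gauss) = (\<integral>g. f' p g \<partial>std_gauss)"
      by (rule st(2) [OF measurable_sum_exp_std_gauss(2) prems]) (rule that)+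
    then show ?thesis
      using i that by (simp add: f'_def)
  qed
qed

subsection \<open>Slepian comparison\<close>

text \<open>Both families are linear forms in one standard Gaussian vector, so covariances are inner
  products of coefficients and \<open>orth\<close> encodes independence. Along the rotation from
  \<open>a\<close> to \<open>b\<close> the derivative of the expectation is a double sum of
  nonnegative terms.\<close>

lemma slepian_sum_exp_powr:
  fixes a b :: "'p \<Rightarrow> 'k::finite \<Rightarrow> real"
  assumes P: "finite P" "P \<noteq> {}" and r: "0 < r" "r \<le> 1"
    and orth: "\<And>p q. p \<in> P \<Longrightarrow> q \<in> P \<Longrightarrow> (\<Sum>k\<in>UNIV. a p k * b q k) = 0"
    and var: "\<And>p. p \<in> P \<Longrightarrow> (\<Sum>k\<in>UNIV. a p k * a p k) = (\<Sum>k\<in>UNIV. b p k * b p k)"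
    and cov: "\<And>p q. p \<in> P \<Longrightarrow> q \<in> P \<Longrightarrow> (\<Sum>k\<in>UNIV. b p k * b q k) \<le> (\<Sum>k\<in>UNIV. a p k * a q k)"
  shows "(\<integral>g. sum_exp P (\<lambda>p. lin (a p) g) powr r \<partial>std_gauss)
    \<le> (\<integral>g. sum_exp P (\<lambda>p. lin (b p) g) powr r \<partial>std_gauss)"
proof -
  \<comment> \<open>The rotating coefficients: \<open>a\<close> at time 0 and \<open>b\<close> at
    time \<open>pi / 2\<close>. Next comes their derivative in \<open>t\<close>.\<close>
  define c where "c t p k = cos t * a p k + sin t * b p k" for t p k
  define c' where "c' t p k = cos t * b p k - sin t * a p k" for t p k
  define \<phi> where "\<phi> t = (\<integral>g. sum_exp P (\<lambda>p. lin (c t p) g) powr r \<partial>std_gauss)" for t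
  define H where "H t p q = (\<integral>g. hess r P p q (\<lambda>p. lin (c t p) g) \<partial>std_gauss)" for t p q
  \<comment> \<open>A majorant of both coefficient families that does not depend on
    \<open>t\<close>, as the domination has to be uniform in \<open>t\<close>.\<close>
  define d where "d p k = \<bar>a p k\<bar> + \<bar>b p k\<bar>" for p k
  have dc: "\<bar>c t p k\<bar> \<le> d p k" "\<bar>c' t p k\<bar> \<le> d p k" "0 \<le> d p k" for t p k
  proof -
    have "\<bar>cos t * u\<bar> \<le> \<bar>u\<bar>" "\<bar>sin t * u\<bar> \<le> \<bar>u\<bar>" for u
      by (simp_all add: abs_mult mult_left_le_one_le)
    then show "\<bar>c t p k\<bar> \<le> d p k" "\<bar>c' t p k\<bar> \<le> d p k"
      unfolding c_def c'_def d_def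
      by (smt (verit))+
  qed (simp add: d_def)
  define R where "R = (\<Sum>q\<in>P. \<Sum>k\<in>UNIV. d q k)"
  define C :: real where "C = 2 + 2 * card P"
  have R0: "R \<ge> 0"
    using dc by (simp add: R_def sum_nonneg)
  have C0: "C \<ge> 0"
    by (simp add: C_def)
  have w0: "0 \<le> R * (\<Sum>k\<in>UNIV. \<bar>g k\<bar>)" for g
    using R0 by (simp add: sum_nonneg)
  have wc: "\<bar>lin (c t p) g\<bar> \<le> R * (\<Sum>k\<in>UNIV. \<bar>g k\<bar>)" "\<bar>lin (c' t p) g\<bar> \<le> R * (\<Sum>k\<in>UNIV. \<bar>g k\<bar>)"
    if "p \<in> P" for t p g
    unfolding R_def by (rule abs_lin_le [OF P(1) that], rule dc, rule dc)+
  have deriv: "(\<phi> has_real_derivative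
      (\<integral>g. (\<Sum>p\<in>P. lin (c' t p) g * grad r P p (\<lambda>p. lin (c t p) g)) \<partial>std_gauss)) (at t)" for t
    unfolding \<phi>_def
  \<comment> \<open>The rate is \<open>2 * R\<close> because the linear form and \<open>grad\<close>
    each contribute one exponential with rate \<open>R\<close>.\<close>
  proof (rule DERIV_integral_dominated [where
        w = "\<lambda>g. card P * C * exp ((2 * R) * (\<Sum>k\<in>UNIV. \<bar>g k\<bar>))"])
    show "((\<lambda>t. sum_exp P (\<lambda>p. lin (c t p) g) powr r) has_real_derivative
        (\<Sum>p\<in>P. lin (c' t p) g * grad r P p (\<lambda>p. lin (c t p) g))) (at t)" for t g
      by (rule DERIV_sum_exp_powr_grad [OF P])
        (auto simp: c_def c'_def intro!: derivative_eq_intros sum.cong)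
    show "integrable std_gauss (\<lambda>g. sum_exp P (\<lambda>p. lin (c t p) g) powr r)" for t
      by (rule integrable_sum_exp_powr [OF P r])
    show "(\<lambda>g. \<Sum>p\<in>P. lin (c' t p) g * grad r P p (\<lambda>p. lin (c t p) g)) \<in> borel_measurable std_gauss"
      by measurable
    show "integrable std_gauss (\<lambda>g. card P * C * exp ((2 * R) * (\<Sum>k\<in>(UNIV::'k set). \<bar>g k\<bar>)))"
      by (rule integrable_std_gauss_bound [where C = "card P * C" and R = "2 * R"])
        (use C0 in auto)
    show "\<bar>\<Sum>p\<in>P. lin (c' t p) g * grad r P p (\<lambda>p. lin (c t p) g)\<bar>
        \<le> card P * C * exp ((2 * R) * (\<Sum>k\<in>UNIV. \<bar>g k\<bar>))" for t g
    proof -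
      let ?w = "R * (\<Sum>k\<in>UNIV. \<bar>g k\<bar>)"
      have "\<bar>lin (c' t p) g * grad r P p (\<lambda>p. lin (c t p) g)\<bar> \<le> exp ?w * (C * exp ?w)"
        if "p \<in> P" for p
      proof -
        have "?w \<le> exp ?w"
          using exp_ge_add_one_self [of ?w] by linarith
        then have "\<bar>lin (c' t p) g\<bar> \<le> exp ?w"
          using wc(2) [OF that, of t g] by linarith
        moreover have "\<bar>grad r P p (\<lambda>p. lin (c t p) g)\<bar> \<le> C * exp ?w"
          unfolding C_def by (rule grad_bound [OF P r w0 wc(1) that])
        ultimately show ?thesis
          unfolding abs_mult by (intro mult_mono) auto
      qed
      then have "\<bar>\<Sum>p\<in>P. lin (c' t p) g * grad r P p (\<lambda>p. lin (c t p) g)\<bar> \<le> (\<Sum>p\<in>P. exp ?w * (C * exp ?w))"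
        by (intro order_trans [OF sum_abs] sum_mono)
      then show ?thesis
        by (simp add: algebra_simps exp_add [symmetric] flip: mult_2)
    qed
  qed
  have gauss: "(\<integral>g. (\<Sum>p\<in>P. lin (c' t p) g * grad r P p (\<lambda>p. lin (c t p) g)) \<partial>std_gauss)
      = (\<Sum>p\<in>P. \<Sum>q\<in>P. (\<Sum>k\<in>UNIV. c' t p k * c t q k) * H t p q)" for t
  proof -
    have "(\<integral>g. (\<Sum>p\<in>P. lin (c' t p) g * grad r P p (\<lambda>p. lin (c t p) g)) \<partial>std_gauss)
        = (\<integral>g. (\<Sum>p\<in>P. \<Sum>k\<in>UNIV. c' t p k * (g k * grad r P p (\<lambda>p. lin (c t p) g))) \<partial>std_gauss)"
      by (simp add: sum_distrib_right mult_ac)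
    also have "\<dots> = (\<Sum>p\<in>P. \<Sum>k\<in>UNIV. c' t p k * (\<integral>g. g k * grad r P p (\<lambda>p. lin (c t p) g) \<partial>std_gauss))"
      by (simp add: stein_grad_integrable [OF P r])
    also have "\<dots> = (\<Sum>p\<in>P. \<Sum>k\<in>UNIV. c' t p k * (\<Sum>q\<in>P. c t q k * H t p q))"
      by (simp add: stein_grad [OF P r] H_def)
    also have "\<dots> = (\<Sum>p\<in>P. \<Sum>q\<in>P. (\<Sum>k\<in>UNIV. c' t p k * c t q k) * H t p q)"
      by (simp add: sum_distrib_left sum_distrib_right mult_ac) (subst sum.swap, simp)
    finally show ?thesis .
  qed
  \<comment> \<open>The terms with squared cosine or sine carry products of \<open>a\<close> with
    \<open>b\<close>, which vanish by \<open>orth\<close>; only the covariance difference is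
    left.\<close>
  have coef: "(\<Sum>k\<in>UNIV. c' t p k * c t q k)
      = cos t * sin t * ((\<Sum>k\<in>UNIV. b p k * b q k) - (\<Sum>k\<in>UNIV. a p k * a q k))"
    if "p \<in> P" "q \<in> P" for t p q
  proof -
    have "(\<Sum>k\<in>UNIV. c' t p k * c t q k) = (\<Sum>k\<in>UNIV.
        cos t * sin t * (b p k * b q k - a p k * a q k)
        + cos t * cos t * (a q k * b p k) - sin t * sin t * (a p k * b q k))"
      by (intro sum.cong) (auto simp: c_def c'_def algebra_simps)
    also have "\<dots> = cos t * sin t * ((\<Sum>k\<in>UNIV. b p k * b q k) - (\<Sum>k\<in>UNIV. a p k * a q k))
        + cos t * cos t * (\<Sum>k\<in>UNIV. a q k * b p k) - sin t * sin t * (\<Sum>k\<in>UNIV. a p k * b q k)"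
      by (simp add: sum.distrib sum_subtractf sum_distrib_left [symmetric])
    finally show ?thesis
      using orth that by simp
  qed
  have "\<phi> 0 \<le> \<phi> (pi / 2)"
  proof (rule DERIV_nonneg_imp_nondecreasing [where f = \<phi>])
    fix t :: real
    assume t: "0 \<le> t" "t \<le> pi / 2"
    then have cs: "0 \<le> cos t * sin t"
      by (intro mult_nonneg_nonneg cos_ge_zero sin_ge_zero) auto
    have "0 \<le> (\<Sum>k\<in>UNIV. c' t p k * c t q k) * H t p q" if pq: "p \<in> P" "q \<in> P" for p q
    proof (cases "p = q")
      \<comment> \<open>On the diagonal equal variances make the coefficient zero, so the sign of
        \<open>hess\<close> there does not matter.\<close>
      case True
      then show ?thesis
        using coef [OF pq] var pq by simp
    next
      case False
      then have "H t p q \<le> 0"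
        using Bochner_Integration.integral_nonneg [of std_gauss "\<lambda>g. - hess r P p q (\<lambda>p. lin (c t p) g)"]
          hess_nonpos [OF False r]
        by (simp add: H_def)
      moreover have "(\<Sum>k\<in>UNIV. c' t p k * c t q k) \<le> 0"
        unfolding coef [OF pq] using cs cov [OF pq] by (intro mult_nonneg_nonpos) auto
      ultimately show ?thesis
        by (rule mult_nonpos_nonpos [rotated])
    qed
    then have "0 \<le> (\<Sum>p\<in>P. \<Sum>q\<in>P. (\<Sum>k\<in>UNIV. c' t p k * c t q k) * H t p q)"
      by (intro sum_nonneg)
    then show "\<exists>y. (\<phi> has_real_derivative y) (at t) \<and> 0 \<le> y"
      using deriv [of t] unfolding gauss by blast
  qed simp
  then show ?thesis
    by (simp add: \<phi>_def c_def)
qed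

text \<open>Passage to the maximum: the largest summand is the exponential of \<beta> / r times the
  maximum, the sum has at most \<open>card P\<close> times that size, and the outer power
  \<open>r\<close> cancels the division by \<open>r\<close>.\<close>

lemma
  assumes P: "finite P" "P \<noteq> {}" and \<beta>: "0 < \<beta>" and r: "0 < r"
  shows exp_Max_le_sum_exp_powr: "exp (\<beta> * (MAX p\<in>P. z p)) \<le> sum_exp P (\<lambda>p. \<beta> / r * z p) powr r"
    and sum_exp_powr_le_exp_Max:
      "sum_exp P (\<lambda>p. \<beta> / r * z p) powr r \<le> card P powr r * exp (\<beta> * (MAX p\<in>P. z p))"
proof -
  let ?m = "MAX p\<in>P. z p"
  have e: "exp (\<beta> * ?m) = exp (\<beta> / r * ?m) powr r"
    using r by (simp add: powr_def)
  have "?m \<in> z ` P"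
    using P by (intro Max_in) auto
  then obtain p where p: "p \<in> P" "?m = z p"
    by auto
  have "exp (\<beta> / r * z p) \<le> sum_exp P (\<lambda>p. \<beta> / r * z p)"
    unfolding sum_exp_def
    using P p by (intro member_le_sum [where f = "\<lambda>p. exp (\<beta> / r * z p)"]) auto
  then show "exp (\<beta> * ?m) \<le> sum_exp P (\<lambda>p. \<beta> / r * z p) powr r"
    unfolding e using r p by (intro powr_mono2) auto
  have "sum_exp P (\<lambda>p. \<beta> / r * z p) \<le> (\<Sum>p\<in>P. exp (\<beta> / r * ?m))"
    unfolding sum_exp_def
  proof (intro sum_mono)
    fix p
    assume "p \<in> P"
    then have "z p \<le> ?m"
      using P by (intro Max_ge) auto
    then show "exp (\<beta> / r * z p) \<le> exp (\<beta> / r * ?m)"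
      using r \<beta> by (simp only: exp_le_cancel_iff) (intro mult_left_mono, auto)
  qed
  then have "sum_exp P (\<lambda>p. \<beta> / r * z p) powr r \<le> (card P * exp (\<beta> / r * ?m)) powr r"
    using r sum_exp_pos [OF P] by (intro powr_mono2) (auto simp: less_imp_le)
  then show "sum_exp P (\<lambda>p. \<beta> / r * z p) powr r \<le> card P powr r * exp (\<beta> * ?m)"
    unfolding e by (simp add: powr_mult)
qed

lemma integrable_sum_exp_powr_scaled:
  fixes c :: "'p \<Rightarrow> 'k::finite \<Rightarrow> real"
  assumes "finite P" "P \<noteq> {}" and "0 < r" "r \<le> 1"
  shows "integrable std_gauss (\<lambda>g. sum_exp P (\<lambda>p. s * lin (c p) g) powr r)"
  using integrable_sum_exp_powr [OF assms, of "\<lambda>p k. s * c p k"]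
  by (simp add: sum_distrib_left mult_ac)

text \<open>The case \<open>r = 1\<close> of the preceding lower estimate dominates the integrand by
  a plain sum of exponentials.\<close>

lemma integrable_exp_Max:
  fixes c :: "'p \<Rightarrow> 'k::finite \<Rightarrow> real"
  assumes P: "finite P" "P \<noteq> {}" and \<beta>: "0 < \<beta>"
  shows "integrable std_gauss (\<lambda>g. exp (\<beta> * (MAX p\<in>P. lin (c p) g)))"
proof (rule Bochner_Integration.integrable_bound)
  show "integrable std_gauss (\<lambda>g. sum_exp P (\<lambda>p. \<beta> / 1 * lin (c p) g) powr 1)"
    by (rule integrable_sum_exp_powr_scaled [OF P]) auto
  show "(\<lambda>g. exp (\<beta> * (MAX p\<in>P. lin (c p) g))) \<in> borel_measurable std_gauss"
    using P by measurable
  show "AE g in std_gauss. norm (exp (\<beta> * (MAX p\<in>P. lin (c p) g)))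
      \<le> norm (sum_exp P (\<lambda>p. \<beta> / 1 * lin (c p) g) powr 1)"
    using exp_Max_le_sum_exp_powr [OF P \<beta>, of 1] by (intro AE_I2) simp
qed

text \<open>Replacing the maximum by the smooth functional costs only the factor
  \<open>N powr r\<close>, which tends to 1 as \<open>r\<close> decreases to 0.\<close>

lemma slepian_exp_Max:
  fixes a b :: "'p \<Rightarrow> 'k::finite \<Rightarrow> real"
  assumes P: "finite P" "P \<noteq> {}" and \<beta>: "0 < \<beta>"
    and orth: "\<And>p q. p \<in> P \<Longrightarrow> q \<in> P \<Longrightarrow> (\<Sum>k\<in>UNIV. a p k * b q k) = 0"
    and var: "\<And>p. p \<in> P \<Longrightarrow> (\<Sum>k\<in>UNIV. a p k * a p k) = (\<Sum>k\<in>UNIV. b p k * b p k)"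
    and cov: "\<And>p q. p \<in> P \<Longrightarrow> q \<in> P \<Longrightarrow> (\<Sum>k\<in>UNIV. b p k * b q k) \<le> (\<Sum>k\<in>UNIV. a p k * a q k)"
  shows "(\<integral>g. exp (\<beta> * (MAX p\<in>P. lin (a p) g)) \<partial>std_gauss)
    \<le> (\<integral>g. exp (\<beta> * (MAX p\<in>P. lin (b p) g)) \<partial>std_gauss)"
proof -
  define N :: real where "N = card P"
  have N: "N > 0"
    using P by (simp add: N_def card_gt_0_iff)
  note int = integrable_exp_Max [OF P \<beta>]
  note intS = integrable_sum_exp_powr_scaled [OF P]
  note sand = exp_Max_le_sum_exp_powr [OF P \<beta>] sum_exp_powr_le_exp_Max [OF P \<beta>, folded N_def]
  have lin_scale: "s * lin c g = lin (\<lambda>k. s * c k) g" for s c and g :: "'k \<Rightarrow> real"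
    by (simp add: sum_distrib_left mult_ac)
  have le: "(\<integral>g. exp (\<beta> * (MAX p\<in>P. lin (a p) g)) \<partial>std_gauss)
      \<le> N powr r * (\<integral>g. exp (\<beta> * (MAX p\<in>P. lin (b p) g)) \<partial>std_gauss)"
    if r: "0 < r" "r \<le> 1" for r
  proof -
    \<comment> \<open>Scaling both families by \<beta> / r multiplies all covariances by the same
      square, so the hypotheses of the smooth comparison persist.\<close>
    have sc: "(\<Sum>k\<in>UNIV. \<beta> / r * f k * (\<beta> / r * h k)) = (\<beta> / r)\<^sup>2 * (\<Sum>k\<in>UNIV. f k * h k)" for f h :: "'k \<Rightarrow> real"
      by (simp add: sum_distrib_left power2_eq_square mult_ac)
    have "(\<integral>g. exp (\<beta> * (MAX p\<in>P. lin (a p) g)) \<partial>std_gauss)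
        \<le> (\<integral>g. sum_exp P (\<lambda>p. \<beta> / r * lin (a p) g) powr r \<partial>std_gauss)"
      by (intro integral_mono int intS r sand)
    also have "\<dots> \<le> (\<integral>g. sum_exp P (\<lambda>p. \<beta> / r * lin (b p) g) powr r \<partial>std_gauss)"
      unfolding lin_scale
      by (rule slepian_sum_exp_powr [OF P r]) (auto simp only: sc orth var intro!: mult_left_mono cov, simp_all)
    also have "\<dots> \<le> (\<integral>g. N powr r * exp (\<beta> * (MAX p\<in>P. lin (b p) g)) \<partial>std_gauss)"
      by (intro integral_mono int intS r sand integrable_mult_right)
    finally show ?thesis
      by simp
  qed
  have "((\<lambda>r. N powr r * (\<integral>g. exp (\<beta> * (MAX p\<in>P. lin (b p) g)) \<partial>std_gauss))
      \<longlongrightarrow> N powr 0 * (\<integral>g. exp (\<beta> * (MAX p\<in>P. lin (b p) g)) \<partial>std_gauss)) (at_right 0)"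
    using N by (intro tendsto_intros) auto
  moreover have "eventually (\<lambda>r. (\<integral>g. exp (\<beta> * (MAX p\<in>P. lin (a p) g)) \<partial>std_gauss)
      \<le> N powr r * (\<integral>g. exp (\<beta> * (MAX p\<in>P. lin (b p) g)) \<partial>std_gauss)) (at_right 0)"
    using eventually_at_right_less le unfolding eventually_at_right_field
    by (intro exI [of _ 1]) auto
  ultimately have "(\<integral>g. exp (\<beta> * (MAX p\<in>P. lin (a p) g)) \<partial>std_gauss)
      \<le> N powr 0 * (\<integral>g. exp (\<beta> * (MAX p\<in>P. lin (b p) g)) \<partial>std_gauss)"
    by (rule tendsto_lowerbound) simp
  then show ?thesis
    using N by simp
qed

subsection \<open>The two Gaussian families\<close>

lemma sum_UNIV_sum:
  fixes f :: "'b::finite + 'c::finite \<Rightarrow> real"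
  shows "(\<Sum>k\<in>UNIV. f k) = (\<Sum>i\<in>UNIV. f (Inl i)) + (\<Sum>j\<in>UNIV. f (Inr j))"
  by (subst UNIV_Plus_UNIV [symmetric], subst sum.Plus) auto

lemma sum_UNIV_prod:
  fixes f :: "'b::finite \<times> 'c::finite \<Rightarrow> real"
  shows "(\<Sum>k\<in>UNIV. f k) = (\<Sum>i\<in>UNIV. \<Sum>j\<in>UNIV. f (i, j))"
  by (subst UNIV_Times_UNIV [symmetric], subst sum.cartesian_product) auto

text \<open>Independence says exactly that the joint law is the product of the marginal laws, each
  of which is standard normal.\<close>

lemma distr_iid_std_normal:
  fixes Z :: "'k::finite \<Rightarrow> 'a \<Rightarrow> real"
  assumes "prob_space M" "iid_std_normal M Z"
  shows "distr M (PiM UNIV (\<lambda>_. borel)) (\<lambda>\<omega> k. Z k \<omega>) = std_gauss"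
proof -
  interpret prob_space M by fact
  have indep: "indep_vars (\<lambda>_. borel) Z UNIV" and d: "distributed M lborel (Z k) std_normal_density" for k
    using assms(2) by (auto simp: iid_std_normal_def)
  have rv: "random_variable borel (Z k)" for k
    using distributed_measurable [OF d] by simp
  have "distr M borel (Z k) = std_normal" for k
    using distributed_distr_eq_density [OF d, of k] by (simp cong: distr_cong)
  then show ?thesis
    using indep_vars_iff_distr_eq_PiM [where I = UNIV and M' = "\<lambda>_. borel" and X = Z] rv indep
    by (simp add: restrict_UNIV)
qed

text \<open>Coefficients of the two exponents as linear forms in one joint vector of scalars.
  Placing both over the same index type lets the comparison act on a single Gaussian vector; the
  nonzero blocks of \<open>matrix_coeff\<close> and \<open>vector_coeff\<close> are
  disjoint.\<close>

definition matrix_coeff :: "(real ^ 'n) \<times> (real ^ 'm) \<Rightarrow> ('m \<times> 'n) + unit + 'm + 'n \<Rightarrow> real" where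
  "matrix_coeff p = (case p of (a, b) \<Rightarrow>
     case_sum (\<lambda>(i, j). b $ i * a $ j) (case_sum (\<lambda>_. norm a * norm b) (\<lambda>_. 0)))"

definition vector_coeff :: "(real ^ 'n) \<times> (real ^ 'm) \<Rightarrow> ('m \<times> 'n) + unit + 'm + 'n \<Rightarrow> real" where
  "vector_coeff p = (case p of (a, b) \<Rightarrow>
     case_sum (\<lambda>_. 0) (case_sum (\<lambda>_. 0) (case_sum (\<lambda>i. norm a * b $ i) (\<lambda>j. norm b * a $ j))))"

lemma lin_matrix_coeff:
  "lin (matrix_coeff (a, b)) (\<lambda>k. scalar_components G s u h k \<omega>)
    = b \<bullet> (G \<omega> *v a) + norm a * norm b * s \<omega>"
  by (simp add: sum_UNIV_sum sum_UNIV_prod matrix_coeff_def inner_vec_def matrix_vector_mult_def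
      sum_distrib_left mult_ac)

lemma lin_vector_coeff:
  "lin (vector_coeff (a, b)) (\<lambda>k. scalar_components G s u h k \<omega>)
    = norm a * (b \<bullet> u \<omega>) + norm b * (h \<omega> \<bullet> a)"
  by (simp add: sum_UNIV_sum sum_UNIV_prod vector_coeff_def inner_vec_def sum_distrib_left mult_ac)

lemma cov_matrix_coeff:
  "(\<Sum>k\<in>UNIV. matrix_coeff (a, b) k * matrix_coeff (a', b') k)
    = (b \<bullet> b') * (a \<bullet> a') + (norm a * norm a') * (norm b * norm b')"
  by (simp add: sum_UNIV_sum sum_UNIV_prod matrix_coeff_def inner_vec_def sum_product mult_ac)

lemma cov_vector_coeff:
  "(\<Sum>k\<in>UNIV. vector_coeff (a, b) k * vector_coeff (a', b') k)
    = (norm a * norm a') * (b \<bullet> b') + (norm b * norm b') * (a \<bullet> a')"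
  by (simp add: sum_UNIV_sum sum_UNIV_prod vector_coeff_def inner_vec_def sum_distrib_left mult_ac)

lemma cov_matrix_vector_coeff:
  "(\<Sum>k\<in>UNIV. matrix_coeff p k * vector_coeff q k) = 0"
  by (simp add: sum_UNIV_sum matrix_coeff_def vector_coeff_def split: prod.split)

text \<open>Both sides equal twice the product of the squared norms; on the matrix side the scalar
  Gaussian supplies one of the two copies.\<close>

lemma var_coeff_eq:
  "(\<Sum>k\<in>UNIV. matrix_coeff p k * matrix_coeff p k) = (\<Sum>k\<in>UNIV. vector_coeff p k * vector_coeff p k)"
  by (cases p) (simp add: cov_matrix_coeff cov_vector_coeff dot_square_norm power2_eq_square)

text \<open>The difference factors into the two Cauchy-Schwarz defects, one for each vector
  space.\<close>

lemma cov_vector_le_matrix: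
  "(\<Sum>k\<in>UNIV. vector_coeff p k * vector_coeff q k) \<le> (\<Sum>k\<in>UNIV. matrix_coeff p k * matrix_coeff q k)"
proof (cases p, cases q)
  fix a b a' b'
  assume pq: "p = (a, b)" "q = (a', b')"
  have "0 \<le> (norm a * norm a' - a \<bullet> a') * (norm b * norm b' - b \<bullet> b')"
    by (intro mult_nonneg_nonneg) (simp_all add: norm_cauchy_schwarz)
  then show ?thesis
    by (simp add: pq cov_matrix_coeff cov_vector_coeff algebra_simps inner_commute)
qed

theorem mainTheorem6:
  fixes M :: "'a measure"
    and l :: nat
    and x :: "nat \<Rightarrow> real ^ 'n" and y :: "nat \<Rightarrow> real ^ 'm"
    and X :: "(real ^ 'n) set" and Y :: "(real ^ 'm) set"
    and c3 :: real
    and G :: "'a \<Rightarrow> real ^ 'n ^ 'm" and u4 :: "'a \<Rightarrow> real"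
    and u2 :: "'a \<Rightarrow> real ^ 'm" and h :: "'a \<Rightarrow> real ^ 'n"
  assumes "prob_space M"
    and "l \<ge> 1"
    and "X = x ` {1..l}" and "Y = y ` {1..l}"
    and "c3 > 0"
    and "iid_std_normal M (scalar_components G u4 u2 h)"
  shows "ln (prob_space.expectation M (\<lambda>\<omega>. exp (c3 *
             (MAX (a, b) \<in> X \<times> Y. b \<bullet> (G \<omega> *v a) + norm a * norm b * u4 \<omega>))))
         \<le> ln (prob_space.expectation M (\<lambda>\<omega>. exp (c3 *
             (MAX (a, b) \<in> X \<times> Y. norm a * (b \<bullet> u2 \<omega>) + norm b * (h \<omega> \<bullet> a)))))"
proof -
  interpret prob_space M by fact
  interpret gauss: prob_space "std_gauss :: (('m \<times> 'n) + unit + 'm + 'n \<Rightarrow> real) measure"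
    by (intro prob_space_PiM prob_space_std_normal)
  let ?P = "X \<times> Y"
  let ?Z = "\<lambda>\<omega> k. scalar_components G u4 u2 h k \<omega>"
  \<comment> \<open>Nonemptiness comes from \<open>l \<ge> 1\<close> and makes the
    \<open>MAX\<close> a genuine maximum.\<close>
  have P: "finite ?P" "?P \<noteq> {}"
    using assms by auto
  have Z: "?Z \<in> measurable M (PiM UNIV (\<lambda>_. borel))"
    using assms(6) by (intro measurable_PiM_single')
      (auto simp: iid_std_normal_def dest!: distributed_measurable)
  \<comment> \<open>The exponents depend on the sample point only through the scalar components, so
    both expectations become integrals against the same product measure.\<close>
  have transfer: "expectation (\<lambda>\<omega>. exp (c3 * (MAX p\<in>?P. lin (c p) (?Z \<omega>))))
      = (\<integral>g. exp (c3 * (MAX p\<in>?P. lin (c p) g)) \<partial>std_gauss)" for c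
    unfolding distr_iid_std_normal [OF assms(1,6), symmetric] using P
    by (subst integral_distr [OF Z]) auto
  have "(\<integral>g. exp (c3 * (MAX p\<in>?P. lin (matrix_coeff p) g)) \<partial>std_gauss)
      \<le> (\<integral>g. exp (c3 * (MAX p\<in>?P. lin (vector_coeff p) g)) \<partial>std_gauss)"
    by (rule slepian_exp_Max [OF P \<open>c3 > 0\<close>])
      (rule cov_matrix_vector_coeff var_coeff_eq cov_vector_le_matrix)+
  \<comment> \<open>Monotonicity of \<open>ln\<close> is applied on the positive reals.
    Integrability matters here, as the integral of a non-integrable function would be 0 by
    convention.\<close>
  moreover have "0 < (\<integral>g. exp (c3 * (MAX p\<in>?P. lin (matrix_coeff p) g)) \<partial>std_gauss)"
    by (rule gauss.expectation_greater [OF integrable_exp_Max [OF P \<open>c3 > 0\<close>]]) simp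
  ultimately have "ln (expectation (\<lambda>\<omega>. exp (c3 * (MAX p\<in>?P. lin (matrix_coeff p) (?Z \<omega>)))))
      \<le> ln (expectation (\<lambda>\<omega>. exp (c3 * (MAX p\<in>?P. lin (vector_coeff p) (?Z \<omega>)))))"
    unfolding transfer by (intro ln_mono)
  moreover have "lin (matrix_coeff p) (?Z \<omega>) = (case p of (a, b) \<Rightarrow> b \<bullet> (G \<omega> *v a) + norm a * norm b * u4 \<omega>)"
    "lin (vector_coeff p) (?Z \<omega>) = (case p of (a, b) \<Rightarrow> norm a * (b \<bullet> u2 \<omega>) + norm b * (h \<omega> \<bullet> a))" for p \<omega>
    by (cases p, simp only: lin_matrix_coeff lin_vector_coeff prod.case)+
  ultimately show ?thesis
    by simp
qed

end
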